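(* Let $L$ be a fully interpreted language without a truth predicate, and let $\mathcal L^0$, constructed from $L$ and $T(x)$ as in the context, be interpreted by the definitional interpretation (a sentence $A$ is true iff $\#A\in G(U)$, false iff $\#A\in F(U)$). Then a sentence of $L$ is true (resp. false) in the interpretation of $L$ iff it is true (resp. false) in the definitional interpretation.
   Context: **Languages.** A language is a countably infinite set of well-formed sentences of finite length over a countable set of symbols, including numerals for natural numbers. Connectives are syntactic operations with unique readability. The language $L$ is closed under $\neg,\vee,\wedge,\rightarrow,\leftrightarrow$, and the components of a compound sentence of $L$ are sentences of $L$. A predicate $P$ with (nonempty) domain $X_P$ is a formula $P(x)$ (possibly with $x$ a tuple of variables) such that $P(x)$ is a sentence for each assignment of $x\in X_P$. For every predicate $P$ of $L$, $\forall xP(x)$ and $\exists xP(x)$ are sentences of $L$. **Fully interpreted.** A language is fully interpreted if every sentence is either true or false (not both) and the classical rules for $\neg,\vee,\wedge,\rightarrow,\leftrightarrow$ hold, and for a predicate $P$ with domain $X_P$, $\forall xP(x)$ is true iff $P(x)$ is true for every $x\in X_P$ (false iff false for some $x\in X_P$), and $\exists xP(x)$ is true iff $P(x)$ is true for some $x\in X_P$ (false iff false for every $x\in X_P$). **The language $\mathcal L$.** $L$ is a fully interpreted language without a truth predicate; $T(x)$ is a new formula not in $L$. $\mathcal L_0$ consists of the sentences of $L$, the sentences $T(\mathbf n)$ for all numerals $\mathbf n$, the sentences $\forall xT(x)$, $\exists xT(x)$, $\forall xT(\lceil T(x)\rceil)$, $\exists xT(\lceil T(x)\rceil)$, and, for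 every predicate $P$ of $L$, the sentences $\forall xT(\lceil P(x)\rceil)$, $\exists xT(\lceil P(x)\rceil)$ (all these are syntactically distinct and not in $L$). $\mathcal L_{n+1}$ consists of $A,\neg A,A\vee B,A\wedge B,A\rightarrow B,A\leftrightarrow B$ for $A,B\in\mathcal L_n$, and $\mathcal L=\bigcup_{n\ge0}\mathcal L_n$. A (injective) Gödel numbering is fixed; $\#A$ is the Gödel number of $A$, $\lceil A\rceil$ the numeral of $\#A$, and $D$ the set of Gödel numbers of all sentences of $\mathcal L$. $U\subseteq D$ is consistent if for no sentence $A$ of $\mathcal L$ both $\#A$ and $\#[\neg A]$ are in $U$. **The sets $G(U)$, $F(U)$.** Let $\mathcal P_1$ (resp. $\mathcal P_2$) be the set of predicates $P$ of $L$ with $P(x)$ true (resp. false) for every $x\in X_P$, and $\mathcal P_3$ the set of those with $P(x)$ true for some but not all $x\in X_P$. Let $W=\{\#A: A$ a true sentence of $L\}$. For a proper subset $U$ of $D$, put $G_0(\emptyset)=W$, and for $U\neq\emptyset$ let $G_0(U)$ be the union of $W$ and the following sets: $\{\#T(\lceil A\rceil): A\in\mathcal L,\ \#A\in U\}$; $\{\#[\neg T(\lceil A\rceil)]: A\in\mathcal L,\ \#[\neg A]\in U\}$; the Gödel numbers of $\neg\forall xT(x)$, $\exists xT(x)$, $\neg\forall xT(\lceil T(x)\rceil)$, $\exists xT(\lceil T(x)\rceil)$; of $\forall xT(\lceil P(x)\rceil)$, $\exists xT(\lceil P(x)\rceil)$ for $P\in\mathcal P_1$; of $\neg\forall xT(\lceil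 P(x)\rceil)$, $\neg\exists xT(\lceil P(x)\rceil)$ for $P\in\mathcal P_2$; of $\neg\forall xT(\lceil P(x)\rceil)$, $\exists xT(\lceil P(x)\rceil)$ for $P\in\mathcal P_3$. Given $G_n(U)$, let $G_{n+1}(U)$ be $G_n(U)$ together with, for all sentences $A,B$ of $\mathcal L$ (writing "$A\in G_n$" for $\#A\in G_n(U)$): $\#[\neg\neg A]$ if $A\in G_n$; $\#[A\vee B]$ if $A\in G_n$ or $B\in G_n$; $\#[A\wedge B]$ if $A,B\in G_n$; $\#[A\rightarrow B]$ if $\neg A\in G_n$ or $B\in G_n$; $\#[A\leftrightarrow B]$ if $A,B\in G_n$ or $\neg A,\neg B\in G_n$; $\#[\neg(A\vee B)]$ if $\neg A,\neg B\in G_n$; $\#[\neg(A\wedge B)]$ if $\neg A\in G_n$ or $\neg B\in G_n$; $\#[\neg(A\rightarrow B)]$ if $A,\neg B\in G_n$; $\#[\neg(A\leftrightarrow B)]$ if $A,\neg B\in G_n$ or $\neg A,B\in G_n$. Put $G(U)=\bigcup_{n\ge 0}G_n(U)$ and $F(U)=\{\#A:\#[\neg A]\in G(U)\}$. **The language $\mathcal L^0$.** $U$ now denotes the smallest consistent subset of $D$ with $U=G(U)$ (it exists). $\mathcal L^0$ is the set of sentences of $\mathcal L$ whose Gödel number is in $G(U)$ or in $F(U)$. *)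

theory Defs
  imports Main "HOL-Library.Countable_Set"
begin

text \<open>
  Expressions (sentences, formulas, numerals) are finite strings of symbols.  The connectives
  are operations on strings.  They are only required to behave well on sentences: for the usual
  concrete notations they are not injective on arbitrary strings.

  The elements of the domains \<open>X\<^sub>P\<close> are taken from a type \<open>'d\<close>; as this type is arbitrary,
  they may be tuples.  \<open>num_obj L n\<close> is the argument that replaces \<open>x\<close> when the numeral of
  \<open>n\<close> is put for \<open>x\<close> in a predicate.
\<close>

record ('a, 'd) lang =
  symbols :: "'a set"
  numl :: "nat \<Rightarrow> 'a list"
  num_obj :: "nat \<Rightarrow> 'd"
  sentences :: "'a list set"
  Neg :: "'a list \<Rightarrow> 'a list"
  Or :: "'a list \<Rightarrow> 'a list \<Rightarrow> 'a list"
  And :: "'a list \<Rightarrow> 'a list \<Rightarrow> 'a list"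
  Imp :: "'a list \<Rightarrow> 'a list \<Rightarrow> 'a list"
  Iff :: "'a list \<Rightarrow> 'a list \<Rightarrow> 'a list"
  predicates :: "'a list set"
  pdom :: "'a list \<Rightarrow> 'd set"
  papp :: "'a list \<Rightarrow> 'd \<Rightarrow> 'a list"
  AllQ :: "'a list \<Rightarrow> 'a list"
  ExQ :: "'a list \<Rightarrow> 'a list"

record 'a interp =
  is_true :: "'a list \<Rightarrow> bool"
  is_false :: "'a list \<Rightarrow> bool"

text \<open>
  A parse of a compound expression, i.e. its main connective and its immediate components.
  Unique readability says that an expression has at most one parse into sentences.
\<close>

datatype 's compound = NegC 's | OrC 's 's | AndC 's 's | ImpC 's 's | IffC 's 's

primrec build :: "('a, 'd) lang \<Rightarrow> 'a list compound \<Rightarrow> 'a list" where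
  "build L (NegC A) = Neg L A"
| "build L (OrC A B) = Or L A B"
| "build L (AndC A B) = And L A B"
| "build L (ImpC A B) = Imp L A B"
| "build L (IffC A B) = Iff L A B"

definition compounds :: "'s set \<Rightarrow> 's compound set" where
  "compounds S = {k. set_compound k \<subseteq> S}"

definition unique_readability :: "('a, 'd) lang \<Rightarrow> 'a list set \<Rightarrow> bool" where
  "unique_readability L S \<longleftrightarrow> inj_on (build L) (compounds S)"

locale language =
  fixes L :: "('a, 'd) lang"
  assumes countable_symbols: "countable (symbols L)"
    and numl_symbols: "numl L n \<in> lists (symbols L)"
    and inj_numl: "inj (numl L)"
    and sentences_symbols: "sentences L \<subseteq> lists (symbols L)"
    and infinite_sentences: "infinite (sentences L)"
    and readable: "unique_readability L (sentences L)"
    and closed: "k \<in> compounds (sentences L) \<Longrightarrow> build L k \<in> sentences L"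
    and predicates_symbols: "predicates L \<subseteq> lists (symbols L)"
    and pdom_nonempty: "P \<in> predicates L \<Longrightarrow> pdom L P \<noteq> {}"
    and papp_sentence: "P \<in> predicates L \<Longrightarrow> x \<in> pdom L P \<Longrightarrow> papp L P x \<in> sentences L"
    and AllQ_sentence: "P \<in> predicates L \<Longrightarrow> AllQ L P \<in> sentences L"
    and ExQ_sentence: "P \<in> predicates L \<Longrightarrow> ExQ L P \<in> sentences L"

locale fully_interpreted = language L
  for L :: "('a, 'd) lang" +
  fixes V :: "'a interp"
  assumes bivalent: "A \<in> sentences L \<Longrightarrow> is_true V A \<noteq> is_false V A"
    and true_Neg: "A \<in> sentences L \<Longrightarrow> is_true V (Neg L A) \<longleftrightarrow> is_false V A"
    and true_Or: "A \<in> sentences L \<Longrightarrow> B \<in> sentences L \<Longrightarrow>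
      is_true V (Or L A B) \<longleftrightarrow> is_true V A \<or> is_true V B"
    and true_And: "A \<in> sentences L \<Longrightarrow> B \<in> sentences L \<Longrightarrow>
      is_true V (And L A B) \<longleftrightarrow> is_true V A \<and> is_true V B"
    and true_Imp: "A \<in> sentences L \<Longrightarrow> B \<in> sentences L \<Longrightarrow>
      is_true V (Imp L A B) \<longleftrightarrow> (is_true V A \<longrightarrow> is_true V B)"
    and true_Iff: "A \<in> sentences L \<Longrightarrow> B \<in> sentences L \<Longrightarrow>
      is_true V (Iff L A B) \<longleftrightarrow> (is_true V A \<longleftrightarrow> is_true V B)"
    and true_AllQ: "P \<in> predicates L \<Longrightarrow>
      is_true V (AllQ L P) \<longleftrightarrow> (\<forall>x\<in>pdom L P. is_true V (papp L P x))"
    and false_AllQ: "P \<in> predicates L \<Longrightarrow>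
      is_false V (AllQ L P) \<longleftrightarrow> (\<exists>x\<in>pdom L P. is_false V (papp L P x))"
    and true_ExQ: "P \<in> predicates L \<Longrightarrow>
      is_true V (ExQ L P) \<longleftrightarrow> (\<exists>x\<in>pdom L P. is_true V (papp L P x))"
    and false_ExQ: "P \<in> predicates L \<Longrightarrow>
      is_false V (ExQ L P) \<longleftrightarrow> (\<forall>x\<in>pdom L P. is_false V (papp L P x))"

text \<open>
  \<open>g\<close> is the Goedel numbering.  A truth predicate of \<open>L\<close> is a predicate \<open>P\<close> of \<open>L\<close> for which
  every instance \<open>A \<leftrightarrow> P(\<lceil>A\<rceil>)\<close> of the T-schema, \<open>A\<close> a sentence of \<open>L\<close>, is true.
\<close>

definition truth_predicate ::
  "('a, 'd) lang \<Rightarrow> 'a interp \<Rightarrow> ('a list \<Rightarrow> nat) \<Rightarrow> 'a list \<Rightarrow> bool" where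
  "truth_predicate L V g P \<longleftrightarrow> P \<in> predicates L \<and>
     (\<forall>A\<in>sentences L. num_obj L (g A) \<in> pdom L P \<and>
        is_true V (Iff L A (papp L P (num_obj L (g A)))))"

text \<open>
  The shapes of the new atomic sentences: \<open>T(t)\<close>, \<open>\<forall>xT(x)\<close>, \<open>\<exists>xT(x)\<close>, \<open>\<forall>xT(\<lceil>T(x)\<rceil>)\<close>,
  \<open>\<exists>xT(\<lceil>T(x)\<rceil>)\<close>, \<open>\<forall>xT(\<lceil>P(x)\<rceil>)\<close>, \<open>\<exists>xT(\<lceil>P(x)\<rceil>)\<close>.  A map \<open>\<tau>\<close> gives the actual expressions.
\<close>

datatype 'a tatom =
  TApp "'a list" | AllT | ExT | AllTT | ExTT | AllTP "'a list" | ExTP "'a list"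

definition tatoms :: "('a, 'd) lang \<Rightarrow> 'a tatom set" where
  "tatoms L = {TApp (numl L n) | n. True} \<union> {AllT, ExT, AllTT, ExTT}
     \<union> AllTP ` predicates L \<union> ExTP ` predicates L"

primrec ext_stage :: "('a, 'd) lang \<Rightarrow> ('a tatom \<Rightarrow> 'a list) \<Rightarrow> nat \<Rightarrow> 'a list set" where
  "ext_stage L \<tau> 0 = sentences L \<union> \<tau> ` tatoms L"
| "ext_stage L \<tau> (Suc n) = ext_stage L \<tau> n \<union> build L ` compounds (ext_stage L \<tau> n)"

definition ext_sentences :: "('a, 'd) lang \<Rightarrow> ('a tatom \<Rightarrow> 'a list) \<Rightarrow> 'a list set" where
  "ext_sentences L \<tau> = (\<Union>n. ext_stage L \<tau> n)"

text \<open>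
  The connectives of the extended language are those of \<open>L\<close>, so a compound of sentences of \<open>L\<close>
  is the same sentence in both languages.
\<close>

locale truth_extension =
  fixes L :: "('a, 'd) lang" and \<tau> :: "'a tatom \<Rightarrow> 'a list" and g :: "'a list \<Rightarrow> nat"
  assumes tatoms_distinct: "inj_on \<tau> (tatoms L)"
    and tatoms_new: "\<tau> ` tatoms L \<inter> sentences L = {}"
    and tatoms_atomic: "\<tau> ` tatoms L \<inter> build L ` compounds (ext_sentences L \<tau>) = {}"
    and ext_readable: "unique_readability L (ext_sentences L \<tau>)"
    and components: "k \<in> compounds (ext_sentences L \<tau>) \<Longrightarrow> build L k \<in> sentences L \<Longrightarrow>
      k \<in> compounds (sentences L)"
    and goedel: "inj_on g (ext_sentences L \<tau>)"

definition quote :: "('a, 'd) lang \<Rightarrow> ('a list \<Rightarrow> nat) \<Rightarrow> 'a list \<Rightarrow> 'a list" where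
  "quote L g A = numl L (g A)"

definition D_set :: "('a, 'd) lang \<Rightarrow> ('a tatom \<Rightarrow> 'a list) \<Rightarrow> ('a list \<Rightarrow> nat) \<Rightarrow> nat set" where
  "D_set L \<tau> g = g ` ext_sentences L \<tau>"

definition consistent ::
  "('a, 'd) lang \<Rightarrow> ('a tatom \<Rightarrow> 'a list) \<Rightarrow> ('a list \<Rightarrow> nat) \<Rightarrow> nat set \<Rightarrow> bool" where
  "consistent L \<tau> g U \<longleftrightarrow> \<not> (\<exists>A\<in>ext_sentences L \<tau>. g A \<in> U \<and> g (Neg L A) \<in> U)"

definition preds1 :: "('a, 'd) lang \<Rightarrow> 'a interp \<Rightarrow> 'a list set" where
  "preds1 L V = {P \<in> predicates L. \<forall>x\<in>pdom L P. is_true V (papp L P x)}"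

definition preds2 :: "('a, 'd) lang \<Rightarrow> 'a interp \<Rightarrow> 'a list set" where
  "preds2 L V = {P \<in> predicates L. \<forall>x\<in>pdom L P. is_false V (papp L P x)}"

definition preds3 :: "('a, 'd) lang \<Rightarrow> 'a interp \<Rightarrow> 'a list set" where
  "preds3 L V = {P \<in> predicates L. (\<exists>x\<in>pdom L P. is_true V (papp L P x)) \<and>
     \<not> (\<forall>x\<in>pdom L P. is_true V (papp L P x))}"

definition W_set :: "('a, 'd) lang \<Rightarrow> 'a interp \<Rightarrow> ('a list \<Rightarrow> nat) \<Rightarrow> nat set" where
  "W_set L V g = {g A | A. A \<in> sentences L \<and> is_true V A}"

text \<open>
  The sets \<open>G\<^sub>n(U)\<close> are meant for proper subsets \<open>U\<close> of \<open>D\<close>.  Being total, the functions below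
  are also defined for other \<open>U\<close>, but a consistent subset of \<open>D\<close> is always proper.
\<close>

definition G0 :: "('a, 'd) lang \<Rightarrow> 'a interp \<Rightarrow> ('a tatom \<Rightarrow> 'a list) \<Rightarrow> ('a list \<Rightarrow> nat)
    \<Rightarrow> nat set \<Rightarrow> nat set" where
  "G0 L V \<tau> g U = (if U = {} then W_set L V g else W_set L V g
     \<union> {g (\<tau> (TApp (quote L g A))) | A. A \<in> ext_sentences L \<tau> \<and> g A \<in> U}
     \<union> {g (Neg L (\<tau> (TApp (quote L g A)))) | A. A \<in> ext_sentences L \<tau> \<and> g (Neg L A) \<in> U}
     \<union> {g (Neg L (\<tau> AllT)), g (\<tau> ExT), g (Neg L (\<tau> AllTT)), g (\<tau> ExTT)}
     \<union> {g (\<tau> (AllTP P)) | P. P \<in> preds1 L V} \<union> {g (\<tau> (ExTP P)) | P. P \<in> preds1 L V}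
     \<union> {g (Neg L (\<tau> (AllTP P))) | P. P \<in> preds2 L V}
     \<union> {g (Neg L (\<tau> (ExTP P))) | P. P \<in> preds2 L V}
     \<union> {g (Neg L (\<tau> (AllTP P))) | P. P \<in> preds3 L V}
     \<union> {g (\<tau> (ExTP P)) | P. P \<in> preds3 L V})"

definition G_step :: "('a, 'd) lang \<Rightarrow> ('a tatom \<Rightarrow> 'a list) \<Rightarrow> ('a list \<Rightarrow> nat)
    \<Rightarrow> nat set \<Rightarrow> nat set" where
  "G_step L \<tau> g X = (let S = ext_sentences L \<tau>; holds = (\<lambda>A. g A \<in> X) in X
     \<union> {g (Neg L (Neg L A)) | A. A \<in> S \<and> holds A}
     \<union> {g (Or L A B) | A B. A \<in> S \<and> B \<in> S \<and> (holds A \<or> holds B)}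
     \<union> {g (And L A B) | A B. A \<in> S \<and> B \<in> S \<and> holds A \<and> holds B}
     \<union> {g (Imp L A B) | A B. A \<in> S \<and> B \<in> S \<and> (holds (Neg L A) \<or> holds B)}
     \<union> {g (Iff L A B) | A B. A \<in> S \<and> B \<in> S \<and>
          (holds A \<and> holds B \<or> holds (Neg L A) \<and> holds (Neg L B))}
     \<union> {g (Neg L (Or L A B)) | A B. A \<in> S \<and> B \<in> S \<and> holds (Neg L A) \<and> holds (Neg L B)}
     \<union> {g (Neg L (And L A B)) | A B. A \<in> S \<and> B \<in> S \<and> (holds (Neg L A) \<or> holds (Neg L B))}
     \<union> {g (Neg L (Imp L A B)) | A B. A \<in> S \<and> B \<in> S \<and> holds A \<and> holds (Neg L B)}
     \<union> {g (Neg L (Iff L A B)) | A B. A \<in> S \<and> B \<in> S \<and>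
          (holds A \<and> holds (Neg L B) \<or> holds (Neg L A) \<and> holds B)})"

primrec G_seq :: "('a, 'd) lang \<Rightarrow> 'a interp \<Rightarrow> ('a tatom \<Rightarrow> 'a list) \<Rightarrow> ('a list \<Rightarrow> nat)
    \<Rightarrow> nat set \<Rightarrow> nat \<Rightarrow> nat set" where
  "G_seq L V \<tau> g U 0 = G0 L V \<tau> g U"
| "G_seq L V \<tau> g U (Suc n) = G_step L \<tau> g (G_seq L V \<tau> g U n)"

definition G :: "('a, 'd) lang \<Rightarrow> 'a interp \<Rightarrow> ('a tatom \<Rightarrow> 'a list) \<Rightarrow> ('a list \<Rightarrow> nat)
    \<Rightarrow> nat set \<Rightarrow> nat set" where
  "G L V \<tau> g U = (\<Union>n. G_seq L V \<tau> g U n)"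

definition F :: "('a, 'd) lang \<Rightarrow> 'a interp \<Rightarrow> ('a tatom \<Rightarrow> 'a list) \<Rightarrow> ('a list \<Rightarrow> nat)
    \<Rightarrow> nat set \<Rightarrow> nat set" where
  "F L V \<tau> g U = {g A | A. A \<in> ext_sentences L \<tau> \<and> g (Neg L A) \<in> G L V \<tau> g U}"

text \<open>The smallest consistent fixed point of \<open>G\<close>; \<open>LEAST\<close> refers to inclusion of sets.\<close>

definition U_min :: "('a, 'd) lang \<Rightarrow> 'a interp \<Rightarrow> ('a tatom \<Rightarrow> 'a list) \<Rightarrow> ('a list \<Rightarrow> nat)
    \<Rightarrow> nat set" where
  "U_min L V \<tau> g = (LEAST U. U \<subseteq> D_set L \<tau> g \<and> consistent L \<tau> g U \<and> U = G L V \<tau> g U)"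

definition L0_sentences :: "('a, 'd) lang \<Rightarrow> 'a interp \<Rightarrow> ('a tatom \<Rightarrow> 'a list)
    \<Rightarrow> ('a list \<Rightarrow> nat) \<Rightarrow> 'a list set" where
  "L0_sentences L V \<tau> g = {A \<in> ext_sentences L \<tau>.
     g A \<in> G L V \<tau> g (U_min L V \<tau> g) \<or> g A \<in> F L V \<tau> g (U_min L V \<tau> g)}"

definition definitional_interp :: "('a, 'd) lang \<Rightarrow> 'a interp \<Rightarrow> ('a tatom \<Rightarrow> 'a list)
    \<Rightarrow> ('a list \<Rightarrow> nat) \<Rightarrow> 'a interp" where
  "definitional_interp L V \<tau> g =
     \<lparr>is_true = (\<lambda>A. A \<in> L0_sentences L V \<tau> g \<and> g A \<in> G L V \<tau> g (U_min L V \<tau> g)),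
      is_false = (\<lambda>A. A \<in> L0_sentences L V \<tau> g \<and> g A \<in> F L V \<tau> g (U_min L V \<tau> g))\<rparr>"

end

theory Submission
  imports Defs
begin

text \<open>
  For every set \<open>U\<close> whatsoever, \<open>G(U)\<close> contains the Goedel numbers of exactly those sentences of
  \<open>L\<close> that are true in \<open>L\<close>.  It contains the true ones since \<open>W \<subseteq> G\<^sub>0(U)\<close>.  Conversely, neither
  the new atomic sentences nor their negations are sentences of \<open>L\<close>, and a compound sentence of
  \<open>L\<close> has its components in \<open>L\<close>, so each stage adds only true sentences of \<open>L\<close>.
\<close>

locale interpreted_truth_extension = fully_interpreted L V + truth_extension L \<tau> g
  for L :: "('a, 'd) lang" and V :: "'a interp"
    and \<tau> :: "'a tatom \<Rightarrow> 'a list" and g :: "'a list \<Rightarrow> nat"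
begin

lemma sentence_in_ext: "A \<in> sentences L \<Longrightarrow> A \<in> ext_sentences L \<tau>"
  unfolding ext_sentences_def by (rule UN_I[of 0]) auto

lemma tatom_in_ext: "a \<in> tatoms L \<Longrightarrow> \<tau> a \<in> ext_sentences L \<tau>"
  unfolding ext_sentences_def by (rule UN_I[of 0]) auto

lemma tatom_not_sentence: "a \<in> tatoms L \<Longrightarrow> \<tau> a \<notin> sentences L"
  using tatoms_new by blast

lemma ext_stage_mono: "m \<le> n \<Longrightarrow> ext_stage L \<tau> m \<subseteq> ext_stage L \<tau> n"
  by (rule lift_Suc_mono_le[of "ext_stage L \<tau>"]) auto

text \<open>The stages increase and a compound has only finitely many components, so one stage
  already contains them all. This yields closure of the extended language under the
  connectives.\<close>

lemma compounds_ext_stage: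
  assumes "k \<in> compounds (ext_sentences L \<tau>)"
  obtains n where "k \<in> compounds (ext_stage L \<tau> n)"
proof -
  have "finite (set_compound k)"
    by (cases k) auto
  moreover have "set_compound k \<subseteq> \<Union> (range (ext_stage L \<tau>))"
    using assms by (simp add: compounds_def ext_sentences_def)
  moreover have "subset.chain UNIV (range (ext_stage L \<tau>))"
    unfolding subset_chain_def using ext_stage_mono nat_le_linear by (metis imageE subset_UNIV)
  ultimately obtain X where "X \<in> range (ext_stage L \<tau>)" "set_compound k \<subseteq> X"
    using finite_subset_Union_chain[of "set_compound k" "range (ext_stage L \<tau>)"] by blast
  then show thesis
    using that by (auto simp: compounds_def)
qed

lemma build_in_ext:
  assumes "k \<in> compounds (ext_sentences L \<tau>)"
  shows "build L k \<in> ext_sentences L \<tau>"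
proof -
  obtain n where "k \<in> compounds (ext_stage L \<tau> n)"
    using assms by (rule compounds_ext_stage)
  then have "build L k \<in> ext_stage L \<tau> (Suc n)"
    by simp
  then show ?thesis
    unfolding ext_sentences_def by blast
qed

lemma connectives_in_ext:
  assumes "A \<in> ext_sentences L \<tau>"
  shows "Neg L A \<in> ext_sentences L \<tau>"
    and "B \<in> ext_sentences L \<tau> \<Longrightarrow> Or L A B \<in> ext_sentences L \<tau>"
    and "B \<in> ext_sentences L \<tau> \<Longrightarrow> And L A B \<in> ext_sentences L \<tau>"
    and "B \<in> ext_sentences L \<tau> \<Longrightarrow> Imp L A B \<in> ext_sentences L \<tau>"
    and "B \<in> ext_sentences L \<tau> \<Longrightarrow> Iff L A B \<in> ext_sentences L \<tau>"
  using assms build_in_ext[of "NegC A"] build_in_ext[of "OrC A B"] build_in_ext[of "AndC A B"]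
    build_in_ext[of "ImpC A B"] build_in_ext[of "IffC A B"]
  by (simp_all add: compounds_def)

text \<open>Closure of \<open>L\<close> gives one direction, \<open>components\<close> the other. As
  an equivalence it serves as a rewrite rule that pushes membership in \<open>L\<close> down to
  components.\<close>

lemma build_sentence_iff:
  "k \<in> compounds (ext_sentences L \<tau>) \<Longrightarrow>
    build L k \<in> sentences L \<longleftrightarrow> k \<in> compounds (sentences L)"
  using components closed by blast

lemma connectives_sentence_iff:
  assumes "A \<in> ext_sentences L \<tau>"
  shows "Neg L A \<in> sentences L \<longleftrightarrow> A \<in> sentences L"
    and "B \<in> ext_sentences L \<tau> \<Longrightarrow>
      Or L A B \<in> sentences L \<longleftrightarrow> A \<in> sentences L \<and> B \<in> sentences L"
    and "B \<in> ext_sentences L \<tau> \<Longrightarrow>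
      And L A B \<in> sentences L \<longleftrightarrow> A \<in> sentences L \<and> B \<in> sentences L"
    and "B \<in> ext_sentences L \<tau> \<Longrightarrow>
      Imp L A B \<in> sentences L \<longleftrightarrow> A \<in> sentences L \<and> B \<in> sentences L"
    and "B \<in> ext_sentences L \<tau> \<Longrightarrow>
      Iff L A B \<in> sentences L \<longleftrightarrow> A \<in> sentences L \<and> B \<in> sentences L"
  using assms build_sentence_iff[of "NegC A"] build_sentence_iff[of "OrC A B"]
    build_sentence_iff[of "AndC A B"] build_sentence_iff[of "ImpC A B"]
    build_sentence_iff[of "IffC A B"]
  by (simp_all add: compounds_def)

lemma goedel_eq_iff:
  "A \<in> ext_sentences L \<tau> \<Longrightarrow> B \<in> ext_sentences L \<tau> \<Longrightarrow> g A = g B \<longleftrightarrow> A = B"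
  using goedel by (rule inj_on_eq_iff)

text \<open>If the negation of a new atom were in \<open>L\<close>, so would be its component, the
  atom itself. Injectivity of \<open>g\<close> carries this over to codes, which rules out every
  clause of \<open>G0\<close> other than \<open>W_set\<close>.\<close>

lemma goedel_tatom_neq:
  assumes "A \<in> sentences L" and "a \<in> tatoms L"
  shows "g A \<noteq> g (\<tau> a)" and "g A \<noteq> g (Neg L (\<tau> a))"
  using assms tatom_not_sentence tatom_in_ext sentence_in_ext connectives_in_ext(1)
    connectives_sentence_iff(1) goedel_eq_iff by metis+

lemma tatoms_intros:
  "TApp (quote L g A) \<in> tatoms L" "AllT \<in> tatoms L" "ExT \<in> tatoms L"
  "AllTT \<in> tatoms L" "ExTT \<in> tatoms L"
  "P \<in> predicates L \<Longrightarrow> AllTP P \<in> tatoms L" "P \<in> predicates L \<Longrightarrow> ExTP P \<in> tatoms L"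
  by (auto simp: tatoms_def quote_def)

lemma W_set_iff: "A \<in> sentences L \<Longrightarrow> g A \<in> W_set L V g \<longleftrightarrow> is_true V A"
  by (auto simp: W_set_def sentence_in_ext goedel_eq_iff)

lemma G0_iff:
  assumes "A \<in> sentences L"
  shows "g A \<in> G0 L V \<tau> g U \<longleftrightarrow> is_true V A"
  by (auto simp: G0_def preds1_def preds2_def preds3_def tatoms_intros W_set_iff[OF assms]
      goedel_tatom_neq[OF assms])

text \<open>The induction step for the inclusion of \<open>G\<close> in the truths of
  \<open>L\<close>; the converse inclusion is settled at stage 0.\<close>

lemma G_step_sound:
  assumes X: "\<And>B. B \<in> sentences L \<Longrightarrow> g B \<in> X \<Longrightarrow> is_true V B"
    and A: "A \<in> sentences L" "g A \<in> G_step L \<tau> g X"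
  shows "is_true V A"
proof -
  have true_Neg_iff: "is_true V (Neg L B) \<longleftrightarrow> \<not> is_true V B" if "B \<in> sentences L" for B
    using that bivalent by (auto simp: true_Neg)
  \<comment> \<open>The clauses of \<open>G_step\<close> express falsity of \<open>B\<close> by the
    code of \<open>Neg L B\<close>; this turns it into failure of truth in \<open>V\<close>.\<close>
  have X_Neg: "\<not> is_true V B" if "B \<in> sentences L" "g (Neg L B) \<in> X" for B
    using X[of "Neg L B"] that
    by (simp add: sentence_in_ext connectives_sentence_iff true_Neg_iff)
  \<comment> \<open>In each clause injectivity of \<open>g\<close> identifies \<open>A\<close> with
    the compound displayed there. Its components then lie in \<open>L\<close>, and the classical
    rule for the connective applies.\<close>
  show ?thesis
    using A X_Neg X unfolding G_step_def Let_def Un_iff mem_Collect_eq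
    by (elim disjE exE conjE)
      (simp_all add: goedel_eq_iff sentence_in_ext connectives_in_ext connectives_sentence_iff
        true_Neg_iff true_Or true_And true_Imp true_Iff)
qed

lemma G_seq_sound:
  "A \<in> sentences L \<Longrightarrow> g A \<in> G_seq L V \<tau> g U n \<Longrightarrow> is_true V A"
proof (induction n arbitrary: A)
  case 0
  then show ?case
    by (simp add: G0_iff)
next
  case (Suc n)
  then show ?case
    using G_step_sound[of "G_seq L V \<tau> g U n" A] by simp
qed

text \<open>Arbitrary \<open>U\<close> allows instantiation with \<open>U_min\<close> without
  unfolding its \<open>LEAST\<close>.\<close>

lemma G_iff:
  assumes "A \<in> sentences L"
  shows "g A \<in> G L V \<tau> g U \<longleftrightarrow> is_true V A"
proof
  assume "g A \<in> G L V \<tau> g U"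
  then show "is_true V A"
    using G_seq_sound[OF assms] by (auto simp: G_def)
next
  assume "is_true V A"
  then have "g A \<in> G_seq L V \<tau> g U 0"
    using G0_iff[OF assms] by simp
  then show "g A \<in> G L V \<tau> g U"
    unfolding G_def by blast
qed

lemma F_iff:
  assumes "A \<in> sentences L"
  shows "g A \<in> F L V \<tau> g U \<longleftrightarrow> is_false V A"
proof -
  \<comment> \<open>By injectivity of \<open>g\<close>, the witness in the definition of
    \<open>F\<close> is \<open>A\<close> itself.\<close>
  have "g A \<in> F L V \<tau> g U \<longleftrightarrow> g (Neg L A) \<in> G L V \<tau> g U"
    using sentence_in_ext[OF assms] by (auto simp: F_def goedel_eq_iff)
  also have "\<dots> \<longleftrightarrow> is_false V A"
    using assms by (simp add: G_iff connectives_sentence_iff sentence_in_ext true_Neg)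
  finally show ?thesis .
qed

end

theorem lemma3p1:
  fixes L :: "('a, 'd) lang" and V :: "'a interp"
    and \<tau> :: "'a tatom \<Rightarrow> 'a list" and g :: "'a list \<Rightarrow> nat" and A :: "'a list"
  assumes "fully_interpreted L V"
    and "\<not> (\<exists>P. truth_predicate L V g P)"
    and "truth_extension L \<tau> g"
    and "A \<in> sentences L"
  shows "(is_true V A \<longleftrightarrow> is_true (definitional_interp L V \<tau> g) A) \<and>
         (is_false V A \<longleftrightarrow> is_false (definitional_interp L V \<tau> g) A)"
proof -
  interpret interpreted_truth_extension L V \<tau> g
    using assms(1,3) by (rule interpreted_truth_extension.intro)
  \<comment> \<open>For a sentence of the extended language, a code in \<open>G\<close> or in
    \<open>F\<close> is by itself enough for membership in \<open>L0_sentences\<close>.\<close>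
  show ?thesis
    using assms(4)
    by (auto simp: definitional_interp_def L0_sentences_def G_iff F_iff sentence_in_ext)
qed

end
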